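(* Let $\lambda$ be a nonzero real number. For all integers $n,k$ with $n\ge k\ge 0$, \[ {n \brack k}_{\lambda}^{*} = \sum_{m=k}^n \lambda^{n-m}{n \brack m}{m \brack k}. \]
   Context: The unsigned Stirling numbers of the first kind ${n\brack k}$ are defined by $\frac{1}{k!}\log^k\!\left(\frac{1}{1-t}\right)=\sum_{n=k}^\infty {n\brack k}\frac{t^n}{n!}$ for $k\ge 0$. For nonzero real $\lambda$, the unsigned new type degenerate Stirling numbers of the first kind ${n\brack k}_{\lambda}^{*}$ are defined (as formal power series coefficients) by \[ \frac{1}{k!}\log^k\!\left(\frac{1}{1+\frac{1}{\lambda}\log(1-\lambda t)}\right)=\sum_{n=k}^\infty {n\brack k}_{\lambda}^{*}\frac{t^n}{n!},\qquad k\ge 0. \] *)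

theory Defs
  imports
    "HOL-Computational_Algebra.Formal_Power_Series"
    "HOL-Combinatorics.Stirling"
begin

text \<open>
  The formal logarithm of a power series \<open>f\<close> with constant term \<open>1\<close>; the library series
  \<open>fps_ln 1\<close> is the expansion of $\log(1+t)$.
\<close>
definition fps_log :: "'a::field_char_0 fps \<Rightarrow> 'a fps" where
  "fps_log f = fps_ln 1 oo (f - 1)"

lemma fps_log_nth_0 [simp]: "fps_nth (fps_log f) 0 = 0"
  by (simp add: fps_log_def fps_ln_nth)

lemma fps_deriv_log:
  fixes f :: "'a::field_char_0 fps"
  assumes "fps_nth f 0 = 1"
  shows "fps_deriv (fps_log f) = inverse f * fps_deriv f"
proof -
  have 0: "fps_nth (f - 1) 0 = 0" using assms by simp
  have "fps_deriv (fps_log f) = (inverse (1 + fps_X) oo (f - 1)) * fps_deriv f"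
    unfolding fps_log_def by (subst fps_compose_deriv[OF 0]) (simp add: fps_ln_deriv)
  also have "inverse (1 + fps_X) oo (f - 1) = inverse ((1 + fps_X) oo (f - 1))"
    by (rule fps_inverse_compose[OF 0]) simp
  also have "(1 + fps_X) oo (f - 1) = f"
    by (simp add: fps_compose_add_distrib fps_X_fps_compose_startby0 assms)
  finally show ?thesis .
qed

text \<open>
  The exponential generating function $\frac{1}{k!}\log^k\frac{1}{1-t}$ of the library's
  unsigned Stirling numbers of the first kind.
\<close>
lemma stirling_egf:
  "fps_const (1 / fact k) * fps_log (inverse (1 - fps_X)) ^ k =
     Abs_fps (\<lambda>n. of_nat (stirling n k) / fact n :: 'a::field_char_0)"
proof (induction k)
  case 0
  show ?case
  proof (rule fps_ext)
    fix n show "fps_nth (fps_const (1 / fact 0) * fps_log (inverse (1 - fps_X)) ^ 0) n =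
       fps_nth (Abs_fps (\<lambda>n. of_nat (stirling n 0) / fact n :: 'a)) n"
      by (cases n) auto
  qed
next
  case (Suc k)
  define L :: "'a fps" where "L = fps_log (inverse (1 - fps_X))"
  define F :: "nat \<Rightarrow> 'a fps" where "F = (\<lambda>k. Abs_fps (\<lambda>n. of_nat (stirling n k) / fact n))"
  have inv: "inverse (1 - fps_X :: 'a fps) * (1 - fps_X) = 1"
    by (rule inverse_mult_eq_1) simp
  have "fps_deriv L = inverse (inverse (1 - fps_X)) * fps_deriv (inverse (1 - fps_X))"
    unfolding L_def by (rule fps_deriv_log) simp
  also have "\<dots> = (1 - fps_X) * inverse (1 - fps_X) * inverse (1 - fps_X)"
    by (simp add: fps_inverse_deriv power2_eq_square mult.assoc)
  finally have L': "(1 - fps_X) * fps_deriv L = 1"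
    using inv by (simp add: mult.commute)
  have IH: "fps_const (1 / fact k) * L ^ k = F k"
    using Suc by (simp add: L_def F_def)
  let ?G = "fps_const (1 / fact (Suc k)) * L ^ Suc k"
  have "fps_const (1 / fact (Suc k)) * of_nat (Suc k) = (fps_const (1 / fact k) :: 'a fps)"
    by (simp add: fps_of_nat [symmetric] del: of_nat_Suc)
  then have "fps_deriv ?G = fps_const (1 / fact k) * L ^ k * fps_deriv L"
    by (simp add: fps_deriv_power mult_ac fps_of_nat del: of_nat_Suc power_Suc fact_Suc)
  then have "(1 - fps_X) * fps_deriv ?G = F k * ((1 - fps_X) * fps_deriv L)"
    using IH by (simp add: mult_ac)
  then have G: "(1 - fps_X) * fps_deriv ?G = F k"
    by (simp add: L')
  have D: "fps_nth (fps_deriv (F (Suc k))) n = of_nat (stirling (Suc n) (Suc k)) / fact n" for n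
    using of_nat_neq_0[of n, where ?'a = 'a]
    by (simp add: F_def fact_Suc del: stirling.simps of_nat_Suc)
  have "(1 - fps_X) * fps_deriv (F (Suc k)) = F k"
  proof (rule fps_ext)
    fix n
    have *: "fps_nth ((1 - fps_X) * fps_deriv (F (Suc k))) n =
        of_nat (stirling (Suc n) (Suc k)) / fact n -
        (if n = 0 then 0 else of_nat (stirling n (Suc k)) / fact (n - 1))"
      by (cases n) (simp_all add: left_diff_distrib D del: stirling.simps fps_deriv_nth)
    show "fps_nth ((1 - fps_X) * fps_deriv (F (Suc k))) n = fps_nth (F k) n"
    proof (cases n)
      case 0
      then show ?thesis unfolding * by (simp add: F_def)
    next
      case (Suc m)
      have "stirling (Suc n) (Suc k) = n * stirling n (Suc k) + stirling n k"
        by simp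
      then have "of_nat (stirling (Suc n) (Suc k)) / fact n =
          of_nat n / fact n * of_nat (stirling n (Suc k)) + (of_nat (stirling n k) / fact n :: 'a)"
        by (simp add: add_divide_distrib del: stirling.simps)
      also have "of_nat n / fact n = (1 / fact m :: 'a)"
        using Suc by (simp add: fact_Suc del: of_nat_Suc)
      finally show ?thesis
        unfolding * using Suc by (simp add: F_def del: stirling.simps fact_Suc of_nat_Suc)
    qed
  qed
  with G have "(1 - fps_X) * fps_deriv ?G = (1 - fps_X) * fps_deriv (F (Suc k))"
    by (simp only:)
  moreover have "(1 - fps_X :: 'a fps) \<noteq> 0"
    using inv by auto
  ultimately have "fps_deriv ?G = fps_deriv (F (Suc k))"
    by (simp only: mult_cancel_left) simp
  moreover have "fps_nth ?G 0 = fps_nth (F (Suc k)) 0"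
    by (simp add: F_def L_def)
  ultimately have "?G = F (Suc k)"
    unfolding fps_deriv_eq_iff by (simp del: power_Suc fact_Suc)
  then show ?case by (simp only: L_def F_def)
qed

definition new_degenerate_stirling :: "real \<Rightarrow> nat \<Rightarrow> nat \<Rightarrow> real" where
  "new_degenerate_stirling l n k =
     fact n * fps_nth (fps_const (1 / fact k) *
       fps_log (inverse (1 + fps_const (1 / l) * fps_log (1 - fps_const l * fps_X))) ^ k) n"

lemma new_degenerate_stirling_less: "n < k \<Longrightarrow> new_degenerate_stirling l n k = 0"
  by (simp add: new_degenerate_stirling_def startsby_zero_power_prefix)

end

theory Submission
  imports Defs
begin

text \<open>
  With \<open>L = log (1 / (1 - t))\<close> and \<open>U = L(l t) / l\<close>, the generating function of the degenerate
  numbers is \<open>(L\<^sup>k / k!) \<circ> U\<close>. Expanding the outer series in powers of \<open>U\<close>, and each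
  power \<open>U\<^sup>m = L(l t)\<^sup>m / l\<^sup>m\<close> in powers of \<open>t\<close>, gives the two families of Stirling numbers.
\<close>

lemma fps_log_compose:
  fixes f g :: "'a::field_char_0 fps"
  assumes "fps_nth f 0 = 1" and "fps_nth g 0 = 0"
  shows "fps_log f oo g = fps_log (f oo g)"
  using assms by (simp add: fps_log_def fps_compose_assoc [symmetric] fps_compose_sub_distrib)

text \<open>Both sides have constant term 0, so comparing logarithmic derivatives suffices.\<close>

lemma fps_log_inverse:
  fixes f :: "'a::field_char_0 fps"
  assumes "fps_nth f 0 = 1"
  shows "fps_log (inverse f) = - fps_log f"
proof -
  have inv: "f * inverse f = 1"
    using assms by (simp add: inverse_mult_eq_1')
  have "fps_deriv (fps_log (inverse f)) = f * fps_deriv (inverse f)"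
    using assms by (subst fps_deriv_log) simp_all
  also have "\<dots> = - (f * inverse f) * (inverse f * fps_deriv f)"
    using assms by (simp add: fps_inverse_deriv power2_eq_square algebra_simps)
  also have "\<dots> = fps_deriv (- fps_log f)"
    using assms by (simp add: inv fps_deriv_log)
  finally show ?thesis
    unfolding fps_deriv_eq_iff by simp
qed

lemma stirling_log_power_nth:
  "fps_nth (fps_log (inverse (1 - fps_X)) ^ k) n =
     (fact k * of_nat (stirling n k) / fact n :: 'a::field_char_0)"
proof -
  have "fps_nth (fps_const (1 / fact k) * fps_log (inverse (1 - fps_X)) ^ k) n =
      (of_nat (stirling n k) / fact n :: 'a)"
    by (simp only: stirling_egf fps_nth_Abs_fps)
  then show ?thesis
    by (simp add: field_simps)
qed

theorem theorem2p1:
  fixes l :: real and n k :: nat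
  assumes "l \<noteq> 0" and "k \<le> n"
  shows "new_degenerate_stirling l n k =
    (\<Sum>m=k..n. l ^ (n - m) * real (stirling n m) * real (stirling m k))"
proof -
  define L :: "real fps" where "L = fps_log (inverse (1 - fps_X))"
  define U where "U = fps_const (1 / l) * (L oo (fps_const l * fps_X))"
  have U0: "fps_nth U 0 = 0"
    by (simp add: U_def L_def)
  \<comment> \<open>Used twice: with \<open>V = fps_const l * fps_X\<close> to identify
    \<open>U\<close>, and with \<open>V = U\<close> for the outer logarithm.\<close>
  have compose_inverse: "L oo V = fps_log (inverse (1 - V))" if "fps_nth V 0 = 0" for V
    using that
    by (simp add: L_def fps_log_compose fps_inverse_compose fps_compose_sub_distrib)
  have "1 + fps_const (1 / l) * fps_log (1 - fps_const l * fps_X) = 1 - U"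
    by (simp add: U_def compose_inverse fps_log_inverse)
  then have "fps_log (inverse (1 + fps_const (1 / l) * fps_log (1 - fps_const l * fps_X))) ^ k =
      L ^ k oo U"
    by (simp add: compose_inverse [OF U0, symmetric] fps_compose_power [OF U0])
  then have "new_degenerate_stirling l n k =
      fact n / fact k * (\<Sum>m=0..n. fps_nth (L ^ k) m * fps_nth (U ^ m) n)"
    by (simp add: new_degenerate_stirling_def fps_compose_nth)
  also have "(\<Sum>m=0..n. fps_nth (L ^ k) m * fps_nth (U ^ m) n) =
      (\<Sum>m=k..n. fps_nth (L ^ k) m * fps_nth (U ^ m) n)"
    \<comment> \<open>For \<open>m < k\<close> the coefficient of \<open>L ^ k\<close> vanishes,
      since \<open>stirling m k = 0\<close>.\<close>
    by (rule sum.mono_neutral_right) (auto simp: L_def stirling_log_power_nth)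
  also have "fact n / fact k * \<dots> =
      (\<Sum>m=k..n. l ^ (n - m) * real (stirling n m) * real (stirling m k))"
    unfolding sum_distrib_left
  proof (rule sum.cong [OF refl])
    fix m assume "m \<in> {k..n}"
    \<comment> \<open>Rescaling the variable contributes \<open>l ^ n\<close> and the prefactor of
      \<open>U ^ m\<close> contributes \<open>1 / l ^ m\<close>; as \<open>m \<le> n\<close>, the
      quotient is \<open>l ^ (n - m)\<close>.\<close>
    then have pow: "l ^ n = l ^ (n - m) * l ^ m"
      by (simp flip: power_add)
    have "U ^ m = fps_const (1 / l ^ m) * (L ^ m oo (fps_const l * fps_X))"
      by (simp add: U_def power_mult_distrib fps_const_power power_one_over fps_compose_power)
    then have "fps_nth (U ^ m) n = l ^ (n - m) * fps_nth (L ^ m) n"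
      using \<open>l \<noteq> 0\<close> by (simp add: fps_nth_compose_linear pow)
    then show "fact n / fact k * (fps_nth (L ^ k) m * fps_nth (U ^ m) n) =
        l ^ (n - m) * real (stirling n m) * real (stirling m k)"
      \<comment> \<open>The \<open>fact m\<close> dividing the coefficient of \<open>L ^ k\<close>
        cancels the one multiplying that of \<open>L ^ m\<close>.\<close>
      by (simp add: L_def stirling_log_power_nth)
  qed
  finally show ?thesis .
qed

end
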